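(* Fix integers $q\ge2$, $1\le s\le t$, and $m\ge1$. Any $(n,q,m+1;I_s)$-reconstruction code is also an $(n,q,N+1;I_t)$-reconstruction code for some integer $N$ satisfying, as $n\to\infty$, \[ N\le \frac{m(q-1)^{t-s}}{(t-s)!}\,n^{t-s}+O_{q,s,t,m}\!\left(n^{t-s-1}\right). \]
   Context: $\Sigma_q$ is an alphabet of size $q\ge2$, and $\Sigma_q^n$ is the set of sequences of length $n$ over $\Sigma_q$. For sequences $x,w$, write $x\preccurlyeq w$ if $x$ is a (not necessarily contiguous) subsequence of $w$. For $x\in\Sigma_q^n$ and $t\ge0$, the $t$-insertion ball is $I_t(x)=\{w\in\Sigma_q^{n+t}: x\preccurlyeq w\}$. An $(n,q,N;I_t)$-reconstruction code is a set $\mathcal C\subseteq\Sigma_q^n$ such that $|I_t(x)\cap I_t(y)|<N$ for any two distinct $x,y\in\mathcal C$. $O_{q,s,t,m}(f(n))$ denotes a quantity bounded in absolute value by $C f(n)$ for all sufficiently large $n$, where $C$ and the threshold for $n$ depend only on $q,s,t,m$ (in particular not on the code). *)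

theory Defs
  imports Complex_Main "HOL-Library.Sublist"
begin

definition words :: "'a set \<Rightarrow> nat \<Rightarrow> 'a list set" where
  "words A n = {w. set w \<subseteq> A \<and> length w = n}"

definition insertion_ball :: "'a set \<Rightarrow> nat \<Rightarrow> 'a list \<Rightarrow> 'a list set" where
  "insertion_ball A t x = {w \<in> words A (length x + t). subseq x w}"

text \<open>
  An \<open>(n, q, N; I_t)\<close>-reconstruction code over the alphabet \<open>A\<close>, where \<open>q\<close> is the size of \<open>A\<close>.
\<close>

definition reconstruction_code :: "'a set \<Rightarrow> nat \<Rightarrow> nat \<Rightarrow> nat \<Rightarrow> 'a list set \<Rightarrow> bool" where
  "reconstruction_code A n N t C \<longleftrightarrow>
     C \<subseteq> words A n \<and>
     (\<forall>x\<in>C. \<forall>y\<in>C. x \<noteq> y \<longrightarrow> card (insertion_ball A t x \<inter> insertion_ball A t y) < N)"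

end

(*
  Reading a common supersequence w of x and y greedily from the left, the letters of w used by
  the embedding of x or of y form a common supersequence in which every letter is used.  Where
  x and y agree such a word is forced, and where they disagree there are two choices, each
  placing a letter that serves only one of x and y; at most 2t letters do so.  So all words of
  I_t(x) \<inter> I_t(y) lie above one of at most 4^t fully used words.  Those lying above a word of
  length at most n + s lie above one of the at most m common supersequences of length n + s, each
  of which has C(n+t,t-s)(q-1)^(t-s) + O(n^(t-s-1)) supersequences of length n + t; the others lie
  above one of O(1) words of length at least n + s + 1, each of which has only O(n^(t-s-1))
  supersequences of length n + t.
*)
theory Submission
  imports Defs
begin

section \<open>Fully used common supersequences\<close>

text \<open>Every subsequence-minimal common supersequence occurs here, but members need not be
  minimal: for \<open>ab\<close> and \<open>b\<close> the set contains both \<open>ab\<close> and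
  \<open>bab\<close>.\<close>

fun merges :: "'a list \<Rightarrow> 'a list \<Rightarrow> 'a list set" where
  "merges [] ys = {ys}"
| "merges (x # xs) [] = {x # xs}"
| "merges (x # xs) (y # ys) =
    (if x = y then (#) x ` merges xs ys
     else (#) x ` merges xs (y # ys) \<union> (#) y ` merges (x # xs) ys)"

lemma merges_Nil_right [simp]: "merges xs [] = {xs}"
  by (cases xs) auto

lemma finite_merges [simp]: "finite (merges xs ys)"
  by (induction xs ys rule: merges.induct) auto

lemma subseq_of_merges: "zs \<in> merges xs ys \<Longrightarrow> subseq xs zs \<and> subseq ys zs"
  by (induction xs ys arbitrary: zs rule: merges.induct) (auto split: if_splits)

text \<open>Greedy matching loses nothing: a head equal to the current letter of \<open>ws\<close>
  may always be matched to it. The letter is kept if it matches at least one head and dropped if it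
  matches neither.\<close>

lemma merges_below_common_supseq:
  "subseq xs ws \<Longrightarrow> subseq ys ws \<Longrightarrow> \<exists>zs\<in>merges xs ys. subseq zs ws"
proof (induction ws arbitrary: xs ys)
  case Nil
  then show ?case by (cases xs; cases ys) auto
next
  case (Cons w ws)
  show ?case
  proof (cases "xs = [] \<or> ys = []")
    case True
    then show ?thesis using Cons.prems by auto
  next
    case False
    then obtain x xs' y ys' where xy: "xs = x # xs'" "ys = y # ys'"
      by (meson neq_Nil_conv)
    consider "w = x" "w = y" | "w = x" "w \<noteq> y" | "w \<noteq> x" "w = y" | "w \<noteq> x" "w \<noteq> y"
      by blast
    then show ?thesis
    proof cases
      case 1
      then have "subseq xs' ws" "subseq ys' ws" using Cons.prems xy by auto
      from Cons.IH[OF this] show ?thesis using 1 xy by auto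
    next
      case 2
      then have "subseq xs' ws" "subseq ys ws" using Cons.prems xy by auto
      from Cons.IH[OF this] show ?thesis using 2 xy by auto
    next
      case 3
      then have "subseq xs ws" "subseq ys' ws" using Cons.prems xy by auto
      from Cons.IH[OF this] show ?thesis using 3 xy by auto
    next
      case 4
      then have "subseq xs ws" "subseq ys ws" using Cons.prems xy by auto
      from Cons.IH[OF this] show ?thesis by auto
    qed
  qed
qed

text \<open>The excess of \<open>2 * length zs\<close> over the two lengths counts the letters of
  \<open>zs\<close> that serve only one word. Equal heads leave it unchanged and each two-way branch
  spends one unit, so at most \<open>e\<close> binary choices are made.\<close>

lemma card_merges_le:
  "card {zs \<in> merges xs ys. 2 * length zs \<le> length xs + length ys + e} \<le> 2 ^ e"
proof (induction xs ys arbitrary: e rule: merges.induct)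
  case (1 ys)
  have "card {zs \<in> merges [] ys. 2 * length zs \<le> length [] + length ys + e} \<le> card {ys}"
    by (rule card_mono) auto
  also have "\<dots> \<le> 2 ^ e" by simp
  finally show ?case .
next
  case (2 x xs)
  have "card {zs \<in> merges (x # xs) []. 2 * length zs \<le> length (x # xs) + length [] + e}
      \<le> card {x # xs}"
    by (rule card_mono) auto
  also have "\<dots> \<le> 2 ^ e" by simp
  finally show ?case .
next
  case (3 x xs y ys)
  show ?case
  proof (cases "x = y")
    case True
    have "{zs \<in> merges (x # xs) (y # ys). 2 * length zs \<le> length (x # xs) + length (y # ys) + e}
      = (#) x ` {zs \<in> merges xs ys. 2 * length zs \<le> length xs + length ys + e}"
      using True by auto
    then show ?thesis
      using "3.IH"(1)[OF True, of e] by (simp add: card_image)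
  next
    case False
    \<comment> \<open>Removing the first letter lowers \<open>2 * length zs\<close> by 2 but the sum
      of the lengths by only 1, hence the \<open>+ 1\<close>.\<close>
    let ?L = "{zs \<in> merges xs (y # ys). 2 * length zs + 1 \<le> length xs + length (y # ys) + e}"
    let ?R = "{zs \<in> merges (x # xs) ys. 2 * length zs + 1 \<le> length (x # xs) + length ys + e}"
    have eq: "{zs \<in> merges (x # xs) (y # ys).
        2 * length zs \<le> length (x # xs) + length (y # ys) + e} = (#) x ` ?L \<union> (#) y ` ?R"
      using False by auto
    show ?thesis
    proof (cases e)
      case 0
      \<comment> \<open>A common supersequence is at least as long as each word, so no excess below
        0 is possible and both branches are empty.\<close>
      have L: "2 * length zs \<ge> length xs + length (y # ys)" if "zs \<in> merges xs (y # ys)" for zs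
        using subseq_of_merges[OF that] by (auto dest!: list_emb_length)
      have R: "2 * length zs \<ge> length (x # xs) + length ys" if "zs \<in> merges (x # xs) ys" for zs
        using subseq_of_merges[OF that] by (auto dest!: list_emb_length)
      have "?L = {}" "?R = {}"
        using 0 L R by fastforce+
      then show ?thesis unfolding eq by (simp only: image_empty Un_empty_left card.empty)
    next
      case (Suc d)
      have "card ((#) x ` ?L \<union> (#) y ` ?R) \<le> card ((#) x ` ?L) + card ((#) y ` ?R)"
        by (rule card_Un_le)
      also have "\<dots> = card ?L + card ?R"
        by (simp add: card_image)
      also have "\<dots> \<le> 2 ^ d + 2 ^ d"
        using "3.IH"(2)[OF False, of d] "3.IH"(3)[OF False, of d] Suc
        by (intro add_mono) simp_all
      finally show ?thesis unfolding eq by (simp add: Suc)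
    qed
  qed
qed

lemma subseq_interpolate:
  assumes "subseq zs ws" "length zs \<le> l" "l \<le> length ws"
  shows "\<exists>us. subseq zs us \<and> subseq us ws \<and> length us = l"
  using assms
proof (induction ws arbitrary: zs l rule: list.induct)
  case Nil
  then show ?case by simp
next
  case (Cons w ws)
  show ?case
  proof (cases "l = length (w # ws)")
    case True
    then show ?thesis using Cons.prems by blast
  next
    case False
    then have l: "l \<le> length ws" using Cons.prems by simp
    show ?thesis
    proof (cases "subseq zs ws")
      case True
      from Cons.IH[OF True Cons.prems(2) l] show ?thesis by auto
    next
      case False
      then obtain zs' where zs: "zs = w # zs'" "subseq zs' ws"
        using Cons.prems(1) by (cases zs) (auto split: if_splits)
      then obtain l' where l': "l = Suc l'" using Cons.prems(2) by (cases l) auto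
      from Cons.IH[OF zs(2), of l'] obtain us
        where "subseq zs' us" "subseq us ws" "length us = l'"
        using zs l l' Cons.prems(2) by auto
      then have "subseq zs (w # us) \<and> subseq (w # us) (w # ws) \<and> length (w # us) = l"
        using zs l' by simp
      then show ?thesis by blast
    qed
  qed
qed

section \<open>Sizes of insertion balls\<close>

lemma finite_words [simp]: "finite A \<Longrightarrow> finite (words A n)"
  unfolding words_def by (rule finite_lists_length_eq)

lemma finite_insertion_ball [simp]: "finite A \<Longrightarrow> finite (insertion_ball A t x)"
  unfolding insertion_ball_def by simp

text \<open>A first letter equal to \<open>a\<close> is matched greedily and leaves all insertions
  for \<open>z\<close>; any other first letter is itself an insertion.\<close>

lemma insertion_ball_Cons_subset:
  "insertion_ball A (Suc k) (a # z) \<subseteq>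
     (#) a ` insertion_ball A (Suc k) z \<union> (\<Union>b\<in>A - {a}. (#) b ` insertion_ball A k (a # z))"
proof
  fix w assume w: "w \<in> insertion_ball A (Suc k) (a # z)"
  then obtain b w' where bw: "w = b # w'"
    by (cases w) (auto simp: insertion_ball_def)
  show "w \<in> (#) a ` insertion_ball A (Suc k) z
          \<union> (\<Union>b\<in>A - {a}. (#) b ` insertion_ball A k (a # z))"
    using w bw by (cases "a = b") (auto simp: insertion_ball_def words_def)
qed

text \<open>Pascal's rule, in the shape of the recursion by first letter.\<close>

lemma sum_binomial_step:
  fixes p :: nat
  shows "(\<Sum>i\<le>Suc k. (Suc n choose i) * p ^ i)
    = (\<Sum>i\<le>Suc k. (n choose i) * p ^ i) + p * (\<Sum>i\<le>k. (n choose i) * p ^ i)"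
proof -
  have "(\<Sum>i\<le>Suc k. (Suc n choose i) * p ^ i)
      = 1 + (\<Sum>i\<le>k. (Suc n choose Suc i) * p ^ Suc i)"
    by (subst sum.atMost_Suc_shift) simp
  also have "\<dots> = 1 + (\<Sum>i\<le>k. (n choose Suc i) * p ^ Suc i) + p * (\<Sum>i\<le>k. (n choose i) * p ^ i)"
    by (simp add: algebra_simps sum.distrib sum_distrib_left)
  also have "1 + (\<Sum>i\<le>k. (n choose Suc i) * p ^ Suc i) = (\<Sum>i\<le>Suc k. (n choose i) * p ^ i)"
    by (subst sum.atMost_Suc_shift) simp
  finally show ?thesis .
qed

text \<open>The right side is Levenshtein's formula for the size of an insertion ball; the upper
  bound suffices here. The split by first letter lowers either \<open>z\<close> or \<open>k\<close>,
  hence the nested inductions.\<close>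

lemma card_insertion_ball_le:
  assumes "finite A"
  shows "card (insertion_ball A k z) \<le> (\<Sum>i\<le>k. (length z + k choose i) * (card A - 1) ^ i)"
proof (induction z arbitrary: k)
  case Nil
  have "insertion_ball A k [] = {w. set w \<subseteq> A \<and> length w = k}"
    by (auto simp: insertion_ball_def words_def)
  then have "card (insertion_ball A k []) = card A ^ k"
    using card_lists_length_eq[OF assms] by simp
  \<comment> \<open>Only an inequality: for empty \<open>A\<close> the truncated subtraction gives
    base 1.\<close>
  also have "\<dots> \<le> (card A - 1 + 1) ^ k"
    by (intro power_mono) auto
  also have "\<dots> = (\<Sum>i\<le>k. (length ([]::'a list) + k choose i) * (card A - 1) ^ i)"
    by (subst binomial) simp
  finally show ?case .
next
  case (Cons a z)
  show ?case
  proof (induction k)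
    case 0
    have "insertion_ball A 0 (a # z) \<subseteq> {a # z}"
      by (auto simp: insertion_ball_def words_def dest: subseq_same_length)
    then have "card (insertion_ball A 0 (a # z)) \<le> card {a # z}"
      by (intro card_mono) auto
    then show ?case by simp
  next
    case (Suc k)
    show ?case
    proof (cases "a \<in> A")
      \<comment> \<open>The word may use letters outside \<open>A\<close>, and then the ball is
        empty. Otherwise \<open>A - {a}\<close> has exactly \<open>card A - 1\<close>
        elements.\<close>
      case False
      have "a \<in> set w" if "subseq (a # z) w" for w
        using that subseq_order.order_trans[of "[a]" "a # z" w]
        by (simp add: subseq_singleton_left)
      then have "insertion_ball A (Suc k) (a # z) = {}"
        using False by (auto simp: insertion_ball_def words_def)
      then show ?thesis by simp
    next
      case True
      let ?p = "card A - 1"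
      have "card (insertion_ball A (Suc k) (a # z))
          \<le> card ((#) a ` insertion_ball A (Suc k) z
                   \<union> (\<Union>b\<in>A - {a}. (#) b ` insertion_ball A k (a # z)))"
        using assms by (intro card_mono insertion_ball_Cons_subset) auto
      also have "\<dots> \<le> card ((#) a ` insertion_ball A (Suc k) z)
                   + card (\<Union>b\<in>A - {a}. (#) b ` insertion_ball A k (a # z))"
        by (rule card_Un_le)
      also have "\<dots> \<le> card (insertion_ball A (Suc k) z)
                   + (\<Sum>b\<in>A - {a}. card ((#) b ` insertion_ball A k (a # z)))"
        using assms by (intro add_mono card_image_le card_UN_le) auto
      also have "\<dots> = card (insertion_ball A (Suc k) z) + ?p * card (insertion_ball A k (a # z))"
        using True assms by (simp add: card_image)
      also have "\<dots> \<le> (\<Sum>i\<le>Suc k. (length z + Suc k choose i) * ?p ^ i)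
                   + ?p * (\<Sum>i\<le>k. (length (a # z) + k choose i) * ?p ^ i)"
        by (intro add_mono mult_left_mono Cons.IH Suc.IH) auto
      also have "\<dots> = (\<Sum>i\<le>Suc k. (length (a # z) + Suc k choose i) * ?p ^ i)"
        using sum_binomial_step[of "length z + Suc k" ?p k] by simp
      finally show ?thesis .
    qed
  qed
qed

text \<open>The length of a merged word below \<open>w\<close> decides the side: up to
  \<open>n + s\<close> it is extended inside \<open>w\<close> to a common supersequence of length
  \<open>n + s\<close>; beyond that it is used directly.\<close>

lemma insertion_ball_inter_subset:
  assumes "length x = n" "length y = n" "s \<le> t"
  shows "insertion_ball A t x \<inter> insertion_ball A t y \<subseteq>
     (\<Union>z \<in> insertion_ball A s x \<inter> insertion_ball A s y. insertion_ball A (t - s) z) \<union>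
     (\<Union>z \<in> {z \<in> merges x y. n + s < length z \<and> length z \<le> n + t}.
        insertion_ball A (n + t - length z) z)"
    (is "_ \<subseteq> ?short \<union> ?long")
proof
  fix w assume w: "w \<in> insertion_ball A t x \<inter> insertion_ball A t y"
  then have len: "length w = n + t" and sub: "set w \<subseteq> A" and xw: "subseq x w" and yw: "subseq y w"
    using assms by (auto simp: insertion_ball_def words_def)
  obtain z where z: "z \<in> merges x y" "subseq z w"
    using merges_below_common_supseq[OF xw yw] by blast
  have lz: "length z \<le> n + t"
    using list_emb_length[OF z(2)] len by simp
  show "w \<in> ?short \<union> ?long"
  proof (cases "length z \<le> n + s")
    case True
    obtain u where u: "subseq z u" "subseq u w" "length u = n + s"
      using subseq_interpolate[OF z(2) True] len assms(3) by auto
    have "set u \<subseteq> A"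
      using u(2) sub by (auto dest: list_emb_set)
    moreover have "subseq x u" "subseq y u"
      using subseq_of_merges[OF z(1)] u(1) subseq_order.order_trans by blast+
    ultimately have "u \<in> insertion_ball A s x \<inter> insertion_ball A s y"
      using u(3) assms by (simp add: insertion_ball_def words_def)
    moreover have "w \<in> insertion_ball A (t - s) u"
      using u len sub assms(3) by (simp add: insertion_ball_def words_def)
    ultimately show ?thesis by blast
  next
    case False
    have "w \<in> insertion_ball A (n + t - length z) z"
      using z(2) len sub lz by (simp add: insertion_ball_def words_def)
    then show ?thesis using False z(1) lz by auto
  qed
qed

lemma card_insertion_ball_inter_le:
  assumes A: "finite A" and len: "length x = n" "length y = n" and st: "s \<le> t"
    and m: "card (insertion_ball A s x \<inter> insertion_ball A s y) \<le> m"
  shows "card (insertion_ball A t x \<inter> insertion_ball A t y)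
    \<le> m * ((n + t choose (t - s)) * (card A - 1) ^ (t - s))
      + (m + 4 ^ t) * (\<Sum>i<t - s. (n + t choose i) * (card A - 1) ^ i)"
proof -
  let ?p = "card A - 1"
  let ?S = "insertion_ball A s x \<inter> insertion_ball A s y"
  let ?Z = "{z \<in> merges x y. n + s < length z \<and> length z \<le> n + t}"
  let ?G = "\<Sum>i<t - s. (n + t choose i) * ?p ^ i"
  let ?B = "(n + t choose (t - s)) * ?p ^ (t - s)"
  have short: "card (insertion_ball A (t - s) z) \<le> ?B + ?G" if "z \<in> ?S" for z
  proof -
    have l: "length z + (t - s) = n + t"
      using that len st by (simp add: insertion_ball_def words_def)
    have "card (insertion_ball A (t - s) z) \<le> (\<Sum>i\<le>t - s. (n + t choose i) * ?p ^ i)"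
      using card_insertion_ball_le[OF A, of "t - s" z] unfolding l .
    also have "\<dots> = ?B + ?G"
      by (simp add: lessThan_Suc_atMost[symmetric])
    finally show ?thesis .
  qed
  have long: "card (insertion_ball A (n + t - length z) z) \<le> ?G" if "z \<in> ?Z" for z
  proof -
    have l: "length z + (n + t - length z) = n + t" using that by simp
    have "card (insertion_ball A (n + t - length z) z)
        \<le> (\<Sum>i\<le>n + t - length z. (n + t choose i) * ?p ^ i)"
      using card_insertion_ball_le[OF A, of "n + t - length z" z] unfolding l .
    \<comment> \<open>A word longer than \<open>n + s\<close> leaves fewer than \<open>t - s\<close>
      insertions, so the leading term is absent.\<close>
    also have "\<dots> \<le> ?G"
      using that by (intro sum_mono2) auto
    finally show ?thesis .
  qed
  \<comment> \<open>Length at most \<open>n + t\<close> means excess at most \<open>2 * t\<close>,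
    whence \<open>2 ^ (2 * t) = 4 ^ t\<close>.\<close>
  have "card ?Z \<le> card {z \<in> merges x y. 2 * length z \<le> length x + length y + 2 * t}"
    using len by (intro card_mono) auto
  also have "\<dots> \<le> 4 ^ t"
    using card_merges_le[of x y "2 * t"] by (simp add: power_mult)
  finally have Z: "card ?Z \<le> 4 ^ t" .
  have "card (insertion_ball A t x \<inter> insertion_ball A t y)
      \<le> card ((\<Union>z\<in>?S. insertion_ball A (t - s) z)
               \<union> (\<Union>z\<in>?Z. insertion_ball A (n + t - length z) z))"
    using A by (intro card_mono insertion_ball_inter_subset[OF len st]) auto
  also have "\<dots> \<le> card (\<Union>z\<in>?S. insertion_ball A (t - s) z)
               + card (\<Union>z\<in>?Z. insertion_ball A (n + t - length z) z)"
    by (rule card_Un_le)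
  also have "\<dots> \<le> (\<Sum>z\<in>?S. card (insertion_ball A (t - s) z))
               + (\<Sum>z\<in>?Z. card (insertion_ball A (n + t - length z) z))"
    using A by (intro add_mono card_UN_le) auto
  also have "\<dots> \<le> card ?S * (?B + ?G) + card ?Z * ?G"
    using sum_bounded_above[of ?S "\<lambda>z. card (insertion_ball A (t - s) z)", OF short]
      sum_bounded_above[of ?Z "\<lambda>z. card (insertion_ball A (n + t - length z) z)", OF long]
    by simp
  also have "\<dots> \<le> m * (?B + ?G) + 4 ^ t * ?G"
    using m Z by (intro add_mono mult_right_mono) auto
  finally show ?thesis by (simp add: algebra_simps)
qed

section \<open>Asymptotics\<close>

text \<open>Isolates the leading power with an explicit error. In the induction step
  \<open>x + c \<le> (c + 1) * x\<close>, valid for \<open>x \<ge> 1\<close>, absorbs the surplus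
  \<open>c * (x + c) ^ Suc j\<close> into the error.\<close>

lemma power_add_le:
  fixes x c :: real
  assumes "1 \<le> x" "0 \<le> c"
  shows "(x + c) ^ Suc j \<le> x ^ Suc j + Suc j * c * (c + 1) ^ j * x ^ j"
proof (induction j)
  case 0
  then show ?case by simp
next
  case (Suc j)
  have "x + c \<le> (c + 1) * x"
    using mult_left_mono[OF assms] by (simp add: algebra_simps)
  then have "(x + c) ^ Suc j \<le> ((c + 1) * x) ^ Suc j"
    using assms by (intro power_mono) auto
  then have 1: "c * (x + c) ^ Suc j \<le> c * (c + 1) ^ Suc j * x ^ Suc j"
    using mult_left_mono[OF _ assms(2), of "(x + c) ^ Suc j" "((c + 1) * x) ^ Suc j"]
    by (simp only: power_mult_distrib mult.assoc)
  have "x * (x + c) ^ Suc j \<le> x * (x ^ Suc j + Suc j * c * (c + 1) ^ j * x ^ j)"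
    using assms Suc by (intro mult_left_mono) auto
  also have "\<dots> = x ^ Suc (Suc j) + Suc j * c * (c + 1) ^ j * x ^ Suc j"
    by (simp add: algebra_simps)
  also have "\<dots> \<le> x ^ Suc (Suc j) + Suc j * c * (c + 1) ^ Suc j * x ^ Suc j"
    using assms by (intro add_left_mono mult_right_mono mult_left_mono power_increasing) auto
  finally have 2: "x * (x + c) ^ Suc j
      \<le> x ^ Suc (Suc j) + Suc j * c * (c + 1) ^ Suc j * x ^ Suc j" .
  have "(x + c) ^ Suc (Suc j) = x * (x + c) ^ Suc j + c * (x + c) ^ Suc j"
    by (simp add: algebra_simps)
  also have "\<dots> \<le> x ^ Suc (Suc j) + Suc j * c * (c + 1) ^ Suc j * x ^ Suc j
      + c * (c + 1) ^ Suc j * x ^ Suc j"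
    using 1 2 by (rule add_mono[rotated])
  also have "\<dots> = x ^ Suc (Suc j) + Suc (Suc j) * c * (c + 1) ^ Suc j * x ^ Suc j"
    by (simp add: algebra_simps)
  finally show ?case .
qed

lemma binomial_le_power_div_fact: "real (n choose k) \<le> real n ^ k / fact k"
proof -
  have "real ((n choose k) * fact k) \<le> real (n ^ k)"
    by (rule of_nat_mono) (rule binomial_fact_pow)
  then show ?thesis by (simp add: field_simps)
qed

text \<open>For \<open>k = 0\<close> the exponent is -1, hence \<open>powi\<close>; the factor
  \<open>k\<close> then makes the error vanish.\<close>

lemma binomial_add_le_leading:
  assumes "1 \<le> n"
  shows "real (n + c choose k)
    \<le> real n ^ k / fact k + k * c * (c + 1) ^ (k - 1) * real n powi (int k - 1)"
proof (cases k)
  case 0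
  then show ?thesis by simp
next
  case (Suc j)
  define R where "R = real (Suc j) * c * (real c + 1) ^ j * real n ^ j"
  have "R \<ge> 0" by (simp add: R_def)
  have "real (n + c choose k) \<le> (real n + real c) ^ Suc j / fact k"
    using binomial_le_power_div_fact[of "n + c" k] Suc by simp
  also have "\<dots> \<le> (real n ^ Suc j + R) / fact k"
    using power_add_le[of "real n" "real c" j] assms unfolding R_def
    by (intro divide_right_mono) auto
  also have "\<dots> = real n ^ k / fact k + R / fact k"
    using Suc by (simp add: add_divide_distrib)
  also have "R / fact k \<le> R / 1"
    using \<open>R \<ge> 0\<close> by (intro divide_left_mono) (auto simp: fact_ge_1)
  finally show ?thesis
    using Suc by (simp add: R_def algebra_simps)
qed

text \<open>Since \<open>n \<ge> 1\<close>, \<open>n + c \<le> (c + 1) * n\<close> and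
  \<open>n ^ i \<le> n ^ (k - 1)\<close>; here \<open>k \<ge> 1\<close>, so \<open>powi\<close> is
  an ordinary power.\<close>

lemma binomial_add_le_lower:
  assumes "1 \<le> n" "i < k"
  shows "real (n + c choose i) \<le> (c + 1) ^ i * real n powi (int k - 1)"
proof -
  obtain j where j: "k = Suc j" using assms(2) by (cases k) auto
  have "real (n + c choose i) \<le> real (n + c) ^ i / fact i"
    by (rule binomial_le_power_div_fact)
  also have "\<dots> \<le> real (n + c) ^ i / 1"
    by (intro divide_left_mono) (auto simp: fact_ge_1)
  also have "real (n + c) \<le> real ((c + 1) * n)"
    using assms(1) by (intro of_nat_mono) simp
  then have "real (n + c) ^ i / 1 \<le> real ((c + 1) * n) ^ i"
    by (simp only: div_by_1) (rule power_mono, auto)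
  also have "\<dots> = (c + 1) ^ i * real n ^ i"
    by (simp only: of_nat_mult of_nat_add of_nat_1 of_nat_power power_mult_distrib)
  also have "\<dots> \<le> (c + 1) ^ i * real n ^ j"
    using assms j by (intro mult_left_mono power_increasing) auto
  finally show ?thesis using j by (simp add: add.commute)
qed

theorem corollary1p10:
  fixes q s t m :: nat
  assumes "2 \<le> q" and "1 \<le> s" and "s \<le> t" and "1 \<le> m"
  shows "\<exists>K::real. \<forall>\<^sub>F n in sequentially.
           \<forall>(A::'a set) (C::'a list set).
             finite A \<and> card A = q \<and> reconstruction_code A n (m + 1) s C \<longrightarrow>
             (\<exists>N::nat. reconstruction_code A n (N + 1) t C \<and>
                real N \<le> real m * (real q - 1) ^ (t - s) / fact (t - s) * real n ^ (t - s)
                          + K * real n powi (int t - int s - 1))"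
proof -
  define k where "k = t - s"
  define p where "p = real q - 1"
  have p: "p \<ge> 0" "real (q - 1) = p"
    using assms by (simp_all add: p_def of_nat_diff)
  have ts: "int t - int s - 1 = int k - 1"
    using assms by (simp add: k_def of_nat_diff)
  \<comment> \<open>The first summand collects the error of the leading binomial, the second all
    lower binomials. It depends only on \<open>q\<close>, \<open>s\<close>, \<open>t\<close>,
    \<open>m\<close> and is 0 when \<open>s = t\<close>.\<close>
  define K where "K = m * p ^ k * (k * t * (t + 1) ^ (k - 1))
    + (m + 4 ^ t) * (\<Sum>i<k. (t + 1) ^ i * p ^ i)"
  show ?thesis
  proof (intro exI[of _ K] eventually_sequentiallyI[of 1] allI impI)
    fix n :: nat and A :: "'a set" and C :: "'a list set"
    assume n: "1 \<le> n"
      and AC: "finite A \<and> card A = q \<and> reconstruction_code A n (m + 1) s C"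
    define E where "E = real n powi (int k - 1)"
    \<comment> \<open>The counting bound itself, the same for all pairs of codewords.\<close>
    define N where "N = m * ((n + t choose k) * (q - 1) ^ k)
      + (m + 4 ^ t) * (\<Sum>i<k. (n + t choose i) * (q - 1) ^ i)"
    have "card (insertion_ball A t x \<inter> insertion_ball A t y) < N + 1"
      if "x \<in> C" "y \<in> C" "x \<noteq> y" for x y
    proof -
      have "card (insertion_ball A s x \<inter> insertion_ball A s y) \<le> m"
        using AC that by (fastforce simp: reconstruction_code_def)
      moreover have "length x = n" "length y = n"
        using AC that by (auto simp: reconstruction_code_def words_def)
      ultimately have "card (insertion_ball A t x \<inter> insertion_ball A t y) \<le> N"
        using card_insertion_ball_inter_le[of A x n y s t m] AC assms
        unfolding N_def k_def by blast
      then show ?thesis by simp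
    qed
    then have code: "reconstruction_code A n (N + 1) t C"
      using AC by (simp add: reconstruction_code_def)
    have "real N = m * (real (n + t choose k) * p ^ k)
        + (m + 4 ^ t) * (\<Sum>i<k. real (n + t choose i) * p ^ i)"
      by (simp only: N_def of_nat_add of_nat_mult of_nat_power of_nat_sum of_nat_numeral p(2))
    also have "\<dots> \<le> m * ((real n ^ k / fact k + k * t * (t + 1) ^ (k - 1) * E) * p ^ k)
        + (m + 4 ^ t) * (\<Sum>i<k. ((t + 1) ^ i * E) * p ^ i)"
      using p n binomial_add_le_leading[of n t k] binomial_add_le_lower[of n _ k t]
      unfolding E_def
      by (intro add_mono mult_left_mono mult_right_mono sum_mono) (auto simp: add.commute)
    also have "\<dots> = real m * p ^ k / fact k * real n ^ k + K * E"
      by (simp add: K_def algebra_simps sum_distrib_left)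
    finally have "real N \<le> real m * p ^ k / fact k * real n ^ k + K * E" .
    with code show "\<exists>N::nat. reconstruction_code A n (N + 1) t C \<and>
        real N \<le> real m * (real q - 1) ^ (t - s) / fact (t - s) * real n ^ (t - s)
          + K * real n powi (int t - int s - 1)"
      unfolding E_def ts p_def k_def by blast
  qed
qed

end
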